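(* Let $n\ge 1$ and let $f\colon\{0,1\}^n\to\{0,1\}$ be a Boolean function with $\mathrm{L}(f)>0$. Then \[ \bigl(D(f)\bigr)^{-1}\;\le\;\mathrm{L}(f)\;\le\;(1+n\ln 2)\cdot\bigl(D(f)\bigr)^{-1}. \]
   Context: A clause is an OR of literals (variables $x_i$ or negations $\neg x_i$); a CNF formula is an AND of clauses, and its size $|\phi|$ is its number of clauses. A depth-3 formula is an OR of CNF formulas $\phi_1\vee\dots\vee\phi_m$, and its size is $\sum_{i=1}^m|\phi_i|$. $\mathrm{L}(f)$ denotes the minimum size of a depth-3 formula computing $f$. $\mathrm{CNF}_f$ is the set of all CNF formulas $\phi$ on the $n$ variables with $\phi^{-1}(1)\subseteq f^{-1}(1)$. For a probability distribution $\mu$ on $f^{-1}(1)$, $D_\mu(f):=\max_{\phi\in\mathrm{CNF}_f}\Pr_{x\sim\mu}[\phi(x)=1]/|\phi|$ (with the convention $0/0=0$), and $D(f):=\min_\mu D_\mu(f)$, the minimum over all distributions $\mu$ on $f^{-1}(1)$. *)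

theory Defs
  imports "HOL-Probability.Probability"
begin

text \<open>
  The \<open>n\<close> variables are the elements of a finite type \<open>'n\<close>, so that \<open>n = CARD('n) \<ge> 1\<close> and the
  cube \<open>{0,1}\<^sup>n\<close> is the type \<open>'n \<Rightarrow> bool\<close>.
\<close>

datatype 'n literal = Pos 'n | Neg 'n

text \<open>
  Clauses and CNF formulas are sets; the empty clause is false and the empty CNF formula is true.
\<close>

type_synonym 'n clause = "'n literal set"
type_synonym 'n cnf = "'n clause set"

instance literal :: (finite) finite
proof
  have "(UNIV :: 'a::finite literal set) = range Pos \<union> range Neg"
  proof (intro equalityI subsetI)
    fix l :: "'a literal"
    show "l \<in> range Pos \<union> range Neg" by (cases l) simp_all
  qed simp
  then show "finite (UNIV :: 'a::finite literal set)"
    by (metis finite finite_UnI finite_imageI)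
qed

fun eval_literal :: "'n literal \<Rightarrow> ('n \<Rightarrow> bool) \<Rightarrow> bool" where
  "eval_literal (Pos i) x \<longleftrightarrow> x i"
| "eval_literal (Neg i) x \<longleftrightarrow> \<not> x i"

definition eval_clause :: "'n clause \<Rightarrow> ('n \<Rightarrow> bool) \<Rightarrow> bool" where
  "eval_clause C x \<longleftrightarrow> (\<exists>l\<in>C. eval_literal l x)"

definition eval_cnf :: "'n cnf \<Rightarrow> ('n \<Rightarrow> bool) \<Rightarrow> bool" where
  "eval_cnf \<phi> x \<longleftrightarrow> (\<forall>C\<in>\<phi>. eval_clause C x)"

definition cnf_size :: "'n cnf \<Rightarrow> nat" where
  "cnf_size \<phi> = card \<phi>"

text \<open>
  A depth-3 formula \<open>\<phi>\<^sub>1 \<or> \<dots> \<or> \<phi>\<^sub>m\<close> is the list of its CNF formulas; \<open>m = 0\<close> is allowed and gives the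
  constant false.
\<close>

type_synonym 'n depth3 = "'n cnf list"

definition eval_depth3 :: "'n depth3 \<Rightarrow> ('n \<Rightarrow> bool) \<Rightarrow> bool" where
  "eval_depth3 \<Phi> x \<longleftrightarrow> (\<exists>\<phi>\<in>set \<Phi>. eval_cnf \<phi> x)"

definition depth3_size :: "'n depth3 \<Rightarrow> nat" where
  "depth3_size \<Phi> = (\<Sum>\<phi>\<leftarrow>\<Phi>. cnf_size \<phi>)"

definition depth3_complexity :: "(('n::finite \<Rightarrow> bool) \<Rightarrow> bool) \<Rightarrow> nat" where
  "depth3_complexity f = (LEAST s. \<exists>\<Phi>. eval_depth3 \<Phi> = f \<and> depth3_size \<Phi> = s)"

definition cnfs_below :: "(('n \<Rightarrow> bool) \<Rightarrow> bool) \<Rightarrow> 'n cnf set" where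
  "cnfs_below f = {\<phi>. {x. eval_cnf \<phi> x} \<subseteq> {x. f x}}"

definition distributions_on :: "'a set \<Rightarrow> 'a pmf set" where
  "distributions_on A = {\<mu>. set_pmf \<mu> \<subseteq> A}"

text \<open>
  Division by zero yields \<open>0\<close>, in accordance with the convention \<open>0/0 = 0\<close>. A zero denominator occurs
  only for the empty CNF formula, which lies in \<open>cnfs_below f\<close> only if \<open>f\<close> is constantly true.
\<close>

definition D_at :: "('n::finite \<Rightarrow> bool) pmf \<Rightarrow> (('n \<Rightarrow> bool) \<Rightarrow> bool) \<Rightarrow> real" where
  "D_at \<mu> f =
    Max ((\<lambda>\<phi>. measure_pmf.prob \<mu> {x. eval_cnf \<phi> x} / real (cnf_size \<phi>)) ` cnfs_below f)"

text \<open>The infimum below is a minimum whenever \<open>f\<close> is satisfiable: see \<open>D_attained\<close>.\<close>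

definition D :: "(('n::finite \<Rightarrow> bool) \<Rightarrow> bool) \<Rightarrow> real" where
  "D f = (INF \<mu>\<in>distributions_on {x. f x}. D_at \<mu> f)"


lemma cnfs_below_finite_nonempty:
  fixes f :: "('n::finite \<Rightarrow> bool) \<Rightarrow> bool"
  shows "finite (cnfs_below f)" and "cnfs_below f \<noteq> {}"
proof -
  show "finite (cnfs_below f)" by simp
  have "{{}} \<in> cnfs_below f"
    by (simp add: cnfs_below_def eval_cnf_def eval_clause_def)
  then show "cnfs_below f \<noteq> {}" by blast
qed

lemma depth3_complexity_attained:
  fixes f :: "('n::finite \<Rightarrow> bool) \<Rightarrow> bool"
  shows "\<exists>\<Phi>. eval_depth3 \<Phi> = f \<and> depth3_size \<Phi> = depth3_complexity f"
proof -
  define T :: "('n \<Rightarrow> bool) \<Rightarrow> 'n cnf"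
    where "T a = (\<lambda>i. {if a i then Pos i else Neg i}) ` UNIV" for a
  have T: "eval_cnf (T a) x \<longleftrightarrow> x = a" for a x
    by (auto simp: T_def eval_cnf_def eval_clause_def fun_eq_iff split: if_splits)
  obtain as where as: "set as = {x. f x}"
    using finite_list[of "{x. f x}"] by auto
  have "eval_depth3 (map T as) x = f x" for x
    by (simp add: eval_depth3_def T as)
  then have "eval_depth3 (map T as) = f" ..
  then have "\<exists>\<Phi>. eval_depth3 \<Phi> = f \<and> depth3_size \<Phi> = depth3_size (map T as)"
    by blast
  then show ?thesis
    unfolding depth3_complexity_def by (rule LeastI)
qed

lemma continuous_on_Max_image:
  fixes h :: "'i \<Rightarrow> 'a::topological_space \<Rightarrow> real"
  assumes "finite A" "A \<noteq> {}" "\<And>i. i \<in> A \<Longrightarrow> continuous_on S (h i)"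
  shows "continuous_on S (\<lambda>v. Max ((\<lambda>i. h i v) ` A))"
  using assms
proof (induction A rule: finite_ne_induct)
  case (insert i A)
  then have "Max ((\<lambda>i. h i v) ` insert i A) = max (h i v) (Max ((\<lambda>i. h i v) ` A))" for v
    by simp
  with insert show ?case
    by (simp add: continuous_on_max)
qed simp

lemma D_attained:
  fixes f :: "('n::finite \<Rightarrow> bool) \<Rightarrow> bool"
  assumes "{x. f x} \<noteq> {}"
  shows "\<exists>\<mu>\<in>distributions_on {x. f x}.
    D f = D_at \<mu> f \<and> (\<forall>\<nu>\<in>distributions_on {x. f x}. D_at \<mu> f \<le> D_at \<nu> f)"
proof -
  define S :: "(real ^ ('n \<Rightarrow> bool)) set" where
    "S = {v. (\<forall>x. 0 \<le> v $ x) \<and> (\<forall>x\<in>{x. \<not> f x}. v $ x = 0) \<and> (\<Sum>x\<in>UNIV. v $ x) = 1}"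
  define g where "g v = Max ((\<lambda>\<phi>. (\<Sum>x | eval_cnf \<phi> x. v $ x) / real (cnf_size \<phi>)) ` cnfs_below f)"
    for v :: "real ^ ('n \<Rightarrow> bool)"
  have g: "D_at \<mu> f = g (\<chi> x. pmf \<mu> x)" for \<mu>
    by (simp add: D_at_def g_def measure_measure_pmf_finite)
  have to_S: "(\<chi> x. pmf \<mu> x) \<in> S" if "\<mu> \<in> distributions_on {x. f x}" for \<mu>
    using that sum_pmf_eq_1[of UNIV \<mu>] by (auto simp: S_def distributions_on_def set_pmf_eq)
  have from_S: "\<exists>\<mu>\<in>distributions_on {x. f x}. v = (\<chi> x. pmf \<mu> x)" if v: "v \<in> S" for v
  proof -
    have p: "pmf (embed_pmf (($) v)) x = v $ x" for x
      using v by (intro pmf_embed_pmf)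
        (auto simp: S_def nn_integral_count_space_finite sum_ennreal)
    then show ?thesis
      using v by (intro bexI[of _ "embed_pmf (($) v)"])
        (auto simp: S_def vec_eq_iff distributions_on_def set_pmf_eq)
  qed
  have "closed S"
    unfolding S_def Collect_conj_eq Collect_all_eq Collect_ball_eq
    by (intro closed_Int closed_INT ballI closed_Collect_le closed_Collect_eq continuous_intros)
  moreover have "norm v \<le> 1" if "v \<in> S" for v
  proof -
    have "norm v \<le> (\<Sum>x\<in>UNIV. \<bar>v $ x\<bar>)" by (rule norm_le_l1_cart)
    also have "\<dots> = 1" using that by (simp add: S_def)
    finally show ?thesis .
  qed
  then have "bounded S" by (auto simp: bounded_iff)
  ultimately have "compact S" by (simp add: compact_eq_bounded_closed)
  moreover obtain a where a: "f a" using assms by blast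
  have "S \<noteq> {}"
    using to_S[of "return_pmf a"] a by (auto simp: distributions_on_def)
  moreover have "continuous_on S g"
    unfolding g_def divide_inverse
    by (intro continuous_on_Max_image cnfs_below_finite_nonempty continuous_intros)
  ultimately obtain v where v: "v \<in> S" "\<forall>w\<in>S. g v \<le> g w"
    using continuous_attains_inf by blast
  obtain \<mu> where \<mu>: "\<mu> \<in> distributions_on {x. f x}" "v = (\<chi> x. pmf \<mu> x)"
    using from_S[OF v(1)] by blast
  have min: "\<forall>\<nu>\<in>distributions_on {x. f x}. D_at \<mu> f \<le> D_at \<nu> f"
    using v(2) to_S by (auto simp: g \<mu>(2))
  then have "D f = D_at \<mu> f"
    unfolding D_def using \<mu>(1) by (intro cInf_eq_minimum) auto
  with \<mu>(1) min show ?thesis by blast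
qed

end

theory Submission
  imports Defs
begin

text \<open>
  Lower bound: for every distribution \<open>\<mu>\<close> on \<open>f\<^sup>-\<^sup>1(1)\<close>, the union bound over the CNFs of an optimal
  depth-3 formula gives \<open>1 \<le> D\<^sub>\<mu>(f) \<cdot> L(f)\<close>. Upper bound: cover \<open>f\<^sup>-\<^sup>1(1)\<close> greedily, applying the
  definition of \<open>D(f)\<close> to the uniform distribution on the set \<open>R\<close> of points not yet covered. A CNF
  \<open>\<phi>\<close> that covers \<open>c\<close> of the \<open>r = |R|\<close> points then costs \<open>|\<phi>| \<le> (c / r) / D(f)\<close>, and these costs
  add up to at most \<open>H\<^sub>N / D(f)\<close> with \<open>N = |f\<^sup>-\<^sup>1(1)| \<le> 2\<^sup>n\<close> and \<open>H\<^sub>N \<le> 1 + ln N\<close>.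
\<close>

lemma depth3_complexity_le: "depth3_complexity (eval_depth3 \<Phi>) \<le> depth3_size \<Phi>"
  unfolding depth3_complexity_def by (rule Least_le) blast

text \<open>Both constants have formulas of size 0: the empty disjunction \<open>[]\<close> is
  false, and \<open>[{}]\<close>, whose only disjunct is the empty CNF, is true.\<close>

lemma depth3_complexity_pos_nonconstant:
  assumes "depth3_complexity f > 0"
  shows "\<exists>x. f x" and "\<exists>x. \<not> f x"
proof -
  have "eval_depth3 \<Phi> \<noteq> f" if "depth3_size \<Phi> = 0" for \<Phi>
    using assms depth3_complexity_le[of \<Phi>] that by auto
  from this[of "[]"] this[of "[{}]"] have "eval_depth3 [] \<noteq> f" "eval_depth3 [{}] \<noteq> f"
    by (simp_all add: depth3_size_def cnf_size_def)
  then show "\<exists>x. f x" "\<exists>x. \<not> f x"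
    by (auto simp: fun_eq_iff eval_depth3_def eval_cnf_def)
qed

text \<open>The empty CNF is constantly true, so a falsifying point of \<open>f\<close> excludes it.
  This keeps the convention for division by zero out of all later estimates.\<close>

lemma cnf_size_pos:
  fixes f :: "('n::finite \<Rightarrow> bool) \<Rightarrow> bool"
  assumes "\<phi> \<in> cnfs_below f" "\<not> f x"
  shows "cnf_size \<phi> > 0"
proof -
  have "\<phi> \<noteq> {}"
    using assms by (auto simp: cnfs_below_def eval_cnf_def)
  then show ?thesis
    by (simp add: cnf_size_def card_gt_0_iff)
qed

lemma prob_le_D_at:
  fixes f :: "('n::finite \<Rightarrow> bool) \<Rightarrow> bool"
  assumes "\<phi> \<in> cnfs_below f" "cnf_size \<phi> > 0"
  shows "measure_pmf.prob \<mu> {x. eval_cnf \<phi> x} \<le> D_at \<mu> f * real (cnf_size \<phi>)"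
proof -
  have "measure_pmf.prob \<mu> {x. eval_cnf \<phi> x} / real (cnf_size \<phi>) \<le> D_at \<mu> f"
    unfolding D_at_def using assms(1) by (intro Max_ge) auto
  then show ?thesis
    using assms(2) by (simp add: pos_divide_le_eq)
qed

lemma D_at_attained:
  fixes f :: "('n::finite \<Rightarrow> bool) \<Rightarrow> bool"
  obtains \<phi> where "\<phi> \<in> cnfs_below f"
    "D_at \<mu> f = measure_pmf.prob \<mu> {x. eval_cnf \<phi> x} / real (cnf_size \<phi>)"
proof -
  have "D_at \<mu> f \<in> (\<lambda>\<phi>. measure_pmf.prob \<mu> {x. eval_cnf \<phi> x} / real (cnf_size \<phi>)) ` cnfs_below f"
    unfolding D_at_def by (intro Max_in) (simp_all add: cnfs_below_finite_nonempty)
  then show ?thesis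
    using that by blast
qed

text \<open>Union bound, one disjunct at a time; the point \<open>y\<close> guarantees that every
  disjunct has positive size.\<close>

lemma prob_eval_depth3_le:
  fixes f :: "('n::finite \<Rightarrow> bool) \<Rightarrow> bool"
  assumes "\<forall>\<phi>\<in>set \<Phi>. \<phi> \<in> cnfs_below f" "\<not> f y"
  shows "measure_pmf.prob \<mu> {x. eval_depth3 \<Phi> x} \<le> D_at \<mu> f * real (depth3_size \<Phi>)"
  using assms(1)
proof (induction \<Phi>)
  case Nil
  then show ?case by (simp add: eval_depth3_def depth3_size_def)
next
  case (Cons \<phi> \<Phi>)
  have "{x. eval_depth3 (\<phi> # \<Phi>) x} = {x. eval_cnf \<phi> x} \<union> {x. eval_depth3 \<Phi> x}"
    by (auto simp: eval_depth3_def)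
  then have "measure_pmf.prob \<mu> {x. eval_depth3 (\<phi> # \<Phi>) x}
      \<le> measure_pmf.prob \<mu> {x. eval_cnf \<phi> x} + measure_pmf.prob \<mu> {x. eval_depth3 \<Phi> x}"
    by (simp add: measure_Un_le)
  also have "\<dots> \<le> D_at \<mu> f * real (cnf_size \<phi>) + D_at \<mu> f * real (depth3_size \<Phi>)"
    using Cons assms(2) by (intro add_mono prob_le_D_at) (auto intro: cnf_size_pos)
  also have "\<dots> = D_at \<mu> f * real (depth3_size (\<phi> # \<Phi>))"
    by (simp add: depth3_size_def algebra_simps)
  finally show ?case .
qed

text \<open>The support of \<open>\<mu>\<close> is nonempty, so \<open>f\<close> is satisfiable and
  the infimum \<open>D f\<close> is an attained minimum.\<close>

lemma D_le_D_at:
  fixes f :: "('n::finite \<Rightarrow> bool) \<Rightarrow> bool"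
  assumes "\<mu> \<in> distributions_on {x. f x}"
  shows "D f \<le> D_at \<mu> f"
proof -
  have "{x. f x} \<noteq> {}"
    using assms set_pmf_not_empty[of \<mu>] by (auto simp: distributions_on_def)
  then show ?thesis
    using D_attained assms by metis
qed

lemma one_le_D_mult_complexity:
  fixes f :: "('n::finite \<Rightarrow> bool) \<Rightarrow> bool"
  assumes "f x" "\<not> f y"
  shows "1 \<le> D f * real (depth3_complexity f)"
proof -
  obtain \<Phi> where \<Phi>: "eval_depth3 \<Phi> = f" "depth3_size \<Phi> = depth3_complexity f"
    using depth3_complexity_attained by blast
  obtain \<mu> where \<mu>: "\<mu> \<in> distributions_on {x. f x}" "D f = D_at \<mu> f"
    using D_attained[of f] assms(1) by blast
  \<comment> \<open>Each disjunct of a formula computing \<open>f\<close> implies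
    \<open>f\<close>.\<close>
  have "\<forall>\<phi>\<in>set \<Phi>. \<phi> \<in> cnfs_below f"
    using \<Phi>(1) by (auto simp: cnfs_below_def eval_depth3_def)
  then have "measure_pmf.prob \<mu> {x. f x} \<le> D f * real (depth3_complexity f)"
    using prob_eval_depth3_le[of \<Phi> f y \<mu>] assms(2) \<Phi> \<mu>(2) by simp
  moreover have "measure_pmf.prob \<mu> {x. f x} = 1"
    using \<mu>(1) by (simp add: distributions_on_def measure_pmf.prob_eq_1 AE_measure_pmf_iff subset_iff)
  ultimately show ?thesis by simp
qed

text \<open>The difference consists of the \<open>c\<close> terms \<open>1/k\<close> with
  \<open>r - c < k \<le> r\<close>, each at least \<open>1/r\<close>.\<close>

lemma harm_diff_ge:
  assumes "c \<le> r"
  shows "real c / real r \<le> harm r - harm (r - c)"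
proof -
  have "harm r - harm (r - c) = (\<Sum>k\<in>{r-c<..r}. inverse (real k))"
  proof -
    have "{1..r} = {1..r-c} \<union> {r-c<..r}" "{1..r-c} \<inter> {r-c<..r} = {}"
      using assms by auto
    then show ?thesis
      unfolding harm_def by (simp only: sum.union_disjoint finite_atLeastAtMost finite_greaterThanAtMost)
  qed
  moreover have "(\<Sum>k\<in>{r-c<..r}. inverse (real r)) \<le> (\<Sum>k\<in>{r-c<..r}. inverse (real k))"
    by (intro sum_mono le_imp_inverse_le) auto
  ultimately show ?thesis
    using assms by (simp add: divide_inverse)
qed

text \<open>The sequence \<open>harm n - ln n\<close> is decreasing and starts with the value 1 at
  \<open>n = 1\<close>.\<close>

lemma harm_le_ln_plus_one:
  assumes "n > 0"
  shows "harm n \<le> ln (real n) + 1"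
  using euler_mascheroni_sequence_decreasing[of 1 n] assms by (simp add: harm_expand)

text \<open>Stated for arbitrary subsets \<open>R\<close> so that the induction can pass to the
  points left uncovered by one greedy choice.\<close>

lemma greedy_cover:
  fixes f :: "('n::finite \<Rightarrow> bool) \<Rightarrow> bool"
  assumes "D f > 0" "\<not> f y" "R \<subseteq> {x. f x}"
  shows "\<exists>\<Phi>. (\<forall>\<phi>\<in>set \<Phi>. \<phi> \<in> cnfs_below f) \<and> R \<subseteq> {x. eval_depth3 \<Phi> x}
    \<and> D f * real (depth3_size \<Phi>) \<le> harm (card R)"
  using assms(3)
proof (induction "card R" arbitrary: R rule: less_induct)
  case less
  show ?case
  proof (cases "R = {}")
    case True
    then show ?thesis
      by (intro exI[of _ "[]"]) (simp add: depth3_size_def harm_def)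
  next
    case False
    define \<mu> where "\<mu> = pmf_of_set R"
    have "\<mu> \<in> distributions_on {x. f x}"
      using less.prems False by (simp add: \<mu>_def distributions_on_def)
    then have D_le: "D f \<le> D_at \<mu> f"
      by (rule D_le_D_at)
    obtain \<phi> where \<phi>: "\<phi> \<in> cnfs_below f"
      "D_at \<mu> f = measure_pmf.prob \<mu> {x. eval_cnf \<phi> x} / real (cnf_size \<phi>)"
      using D_at_attained[of f \<mu>] by blast
    define c where "c = card (R \<inter> {x. eval_cnf \<phi> x})"
    have prob: "measure_pmf.prob \<mu> {x. eval_cnf \<phi> x} = real c / real (card R)"
      using False by (simp add: \<mu>_def c_def measure_pmf_of_set)
    have cost: "D f * real (cnf_size \<phi>) \<le> real c / real (card R)"
      using D_le cnf_size_pos[of \<phi> f y, OF \<phi>(1) assms(2)] unfolding \<phi>(2) prob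
      by (simp only: pos_le_divide_eq of_nat_0_less_iff)
    \<comment> \<open>A positive cost forces \<open>\<phi>\<close> to cover some point of
      \<open>R\<close>, so the uncovered set shrinks strictly and the recursion terminates.\<close>
    have "0 < D f * real (cnf_size \<phi>)"
      using assms(1) cnf_size_pos[of \<phi> f y, OF \<phi>(1) assms(2)] by simp
    then have "c > 0"
      using cost by (cases "c = 0") auto
    define R' where "R' = R - {x. eval_cnf \<phi> x}"
    have c_le: "c \<le> card R"
      unfolding c_def by (intro card_mono) auto
    have card_R': "card R' = card R - c"
      by (simp add: R'_def c_def card_Diff_subset_Int)
    then have "card R' < card R"
      using \<open>c > 0\<close> c_le by simp
    then obtain \<Phi> where \<Phi>: "\<forall>\<psi>\<in>set \<Phi>. \<psi> \<in> cnfs_below f" "R' \<subseteq> {x. eval_depth3 \<Phi> x}"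
      "D f * real (depth3_size \<Phi>) \<le> harm (card R')"
      using less.hyps[of R'] less.prems unfolding R'_def by blast
    \<comment> \<open>The cost of \<open>\<phi>\<close> is paid by the \<open>c\<close>
      largest-index terms of \<open>harm (card R)\<close>, the remaining formula by the
      others.\<close>
    have "D f * real (depth3_size (\<phi> # \<Phi>)) \<le> real c / real (card R) + harm (card R - c)"
      using cost \<Phi>(3) by (simp add: depth3_size_def card_R' algebra_simps)
    also have "\<dots> \<le> harm (card R)"
      using harm_diff_ge[OF c_le] by simp
    finally have "D f * real (depth3_size (\<phi> # \<Phi>)) \<le> harm (card R)" .
    moreover have "R \<subseteq> {x. eval_depth3 (\<phi> # \<Phi>) x}"
      using \<Phi>(2) by (auto simp: R'_def eval_depth3_def)
    ultimately show ?thesis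
      using \<phi>(1) \<Phi>(1) by (intro exI[of _ "\<phi> # \<Phi>"]) simp
  qed
qed

lemma D_mult_complexity_le_harm:
  fixes f :: "('n::finite \<Rightarrow> bool) \<Rightarrow> bool"
  assumes "D f > 0" "\<not> f y"
  shows "D f * real (depth3_complexity f) \<le> harm (card {x. f x})"
proof -
  obtain \<Phi> where \<Phi>: "\<forall>\<phi>\<in>set \<Phi>. \<phi> \<in> cnfs_below f" "{x. f x} \<subseteq> {x. eval_depth3 \<Phi> x}"
    "D f * real (depth3_size \<Phi>) \<le> harm (card {x. f x})"
    using greedy_cover[of f y "{x. f x}", OF assms order_refl] by blast
  \<comment> \<open>Membership in \<open>cnfs_below f\<close> gives soundness, the covering gives
    completeness.\<close>
  have "eval_depth3 \<Phi> = f"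
    using \<Phi>(1,2) by (auto simp: fun_eq_iff eval_depth3_def cnfs_below_def)
  then have "D f * real (depth3_complexity f) \<le> D f * real (depth3_size \<Phi>)"
    using assms(1) depth3_complexity_le[of \<Phi>] by (intro mult_left_mono) auto
  with \<Phi>(3) show ?thesis by simp
qed

theorem theorem2p1:
  fixes f :: "('n::finite \<Rightarrow> bool) \<Rightarrow> bool"
  assumes "depth3_complexity f > 0"
  shows "inverse (D f) \<le> real (depth3_complexity f) \<and>
         real (depth3_complexity f) \<le> (1 + real CARD('n) * ln 2) * inverse (D f)"
proof -
  obtain x y where xy: "f x" "\<not> f y"
    using depth3_complexity_pos_nonconstant[OF assms] by blast
  have lower: "1 \<le> D f * real (depth3_complexity f)"
    by (rule one_le_D_mult_complexity) (fact xy)+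
  then have "0 < D f * real (depth3_complexity f)" by linarith
  \<comment> \<open>The lower bound also supplies the positivity that the greedy argument
    requires.\<close>
  then have pos: "D f > 0"
    using assms by (simp add: zero_less_mult_iff)
  have N_pos: "card {x. f x} > 0"
    using xy(1) by (auto simp: card_gt_0_iff)
  have "card {x. f x} \<le> card (UNIV :: ('n \<Rightarrow> bool) set)"
    by (intro card_mono) auto
  then have "card {x. f x} \<le> 2 ^ CARD('n)"
    by (simp add: card_fun)
  then have N_le: "real (card {x. f x}) \<le> 2 ^ CARD('n)"
    by (metis of_nat_le_iff of_nat_numeral of_nat_power)
  have "D f * real (depth3_complexity f) \<le> harm (card {x. f x})"
    using pos xy(2) by (rule D_mult_complexity_le_harm)
  also have "\<dots> \<le> ln (real (card {x. f x})) + 1"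
    using N_pos by (rule harm_le_ln_plus_one)
  also have "ln (real (card {x. f x})) \<le> ln (2 ^ CARD('n))"
    using N_pos N_le by (subst ln_le_cancel_iff) auto
  finally have "D f * real (depth3_complexity f) \<le> 1 + real CARD('n) * ln 2"
    by (simp add: ln_realpow)
  with lower pos show ?thesis
    by (simp add: field_simps)
qed

end
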